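(* Let $X$ be a Banach space over $F\in\{\mathbb{R},\mathbb{C}\}$, let $k\in\mathbb{N}$, and let $\mathcal{T}=(T_1,T_2,\ldots,T_k)\in L(X)^k$. If the joint numerical range $W(\mathcal{T})\subseteq F^k$ is convex, then the numerical range $W(T_i)\subseteq F$ is convex for each $1\leq i\leq k$.
   Context: $L(X)$ is the space of bounded linear operators on $X$. $S_X$ denotes the unit sphere of $X$, $X^*$ the dual space, and $\Pi_X=\{(x,x^* )\in S_X\times S_{X^*}: x^*(x)=1\}$. For $T\in L(X)$, the numerical range is $W(T)=\{x^*(Tx):(x,x^* )\in\Pi_X\}$. For $\mathcal{T}=(T_1,\ldots,T_k)\in L(X)^k$, the joint numerical range is $W(\mathcal{T})=\{(x^*(T_1x),x^*(T_2x),\ldots,x^*(T_kx)):(x,x^* )\in\Pi_X\}\subseteq F^k$. *)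

theory Defs
  imports "HOL-Analysis.Analysis"
begin

text \<open>
  The library's normed spaces are real. A complex Banach space is a real one with a complex scalar
  multiplication that extends \<open>(*\<^sub>R)\<close> and for which the norm is homogeneous.
\<close>

class complex_banach = banach +
  fixes scaleC :: "complex \<Rightarrow> 'a \<Rightarrow> 'a"  (infixr \<open>*\<^sub>C\<close> 75)
  assumes scaleC_add_right: "a *\<^sub>C (x + y) = a *\<^sub>C x + a *\<^sub>C y"
    and scaleC_add_left: "(a + b) *\<^sub>C x = a *\<^sub>C x + b *\<^sub>C x"
    and scaleC_scaleC: "a *\<^sub>C b *\<^sub>C x = (a * b) *\<^sub>C x"
    and scaleC_of_real: "complex_of_real r *\<^sub>C x = r *\<^sub>R x"
    and norm_scaleC: "norm (a *\<^sub>C x) = norm a * norm x"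

instantiation complex :: complex_banach
begin

definition scaleC_complex_def: "a *\<^sub>C (x::complex) = a * x"

instance
  by standard (simp_all add: scaleC_complex_def algebra_simps scaleR_conv_of_real norm_mult)

end

text \<open>
  The notions below are parametrized by the scalar multiplication \<open>s\<close> of \<open>X\<close> over \<open>F\<close>, to be
  instantiated with \<open>(*\<^sub>R)\<close> (\<open>F\<close> real) or \<open>(*\<^sub>C)\<close> (\<open>F\<close> complex). The type \<open>\<Rightarrow>\<^sub>L\<close> consists of the
  bounded \<^emph>\<open>real\<close>-linear maps, so homogeneity over \<open>F\<close> is imposed separately; its norm is the
  operator norm, which does not depend on the scalar field.
\<close>

definition bounded_operators ::
    "('f::real_normed_field \<Rightarrow> 'x \<Rightarrow> 'x) \<Rightarrow> ('x::real_normed_vector \<Rightarrow>\<^sub>L 'x) set" where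
  "bounded_operators s =
    {T. \<forall>c x. blinfun_apply T (s c x) = s c (blinfun_apply T x)}"

definition dual_space ::
    "('f::real_normed_field \<Rightarrow> 'x \<Rightarrow> 'x) \<Rightarrow> ('x::real_normed_vector \<Rightarrow>\<^sub>L 'f) set" where
  "dual_space s = {f. \<forall>c x. blinfun_apply f (s c x) = c * blinfun_apply f x}"

definition state_pairs ::
    "('f::real_normed_field \<Rightarrow> 'x \<Rightarrow> 'x) \<Rightarrow> ('x::real_normed_vector \<times> ('x \<Rightarrow>\<^sub>L 'f)) set" where
  "state_pairs s =
    {(x, f). x \<in> sphere 0 1 \<and> f \<in> dual_space s \<inter> sphere 0 1 \<and> blinfun_apply f x = 1}"

definition numerical_range ::
    "('f::real_normed_field \<Rightarrow> 'x \<Rightarrow> 'x) \<Rightarrow> ('x::real_normed_vector \<Rightarrow>\<^sub>L 'x) \<Rightarrow> 'f set" where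
  "numerical_range s T =
    {blinfun_apply f (blinfun_apply T x) | x f. (x, f) \<in> state_pairs s}"

definition joint_numerical_range ::
    "('f::real_normed_field \<Rightarrow> 'x \<Rightarrow> 'x) \<Rightarrow> ('x::real_normed_vector \<Rightarrow>\<^sub>L 'x) ^ 'k \<Rightarrow> ('f ^ 'k) set"
  where
  "joint_numerical_range s T =
    {\<chi> i. blinfun_apply f (blinfun_apply (T $ i) x) | x f. (x, f) \<in> state_pairs s}"

lemma bounded_operators_scaleR: "bounded_operators (*\<^sub>R) = UNIV"
  by (simp add: bounded_operators_def blinfun.scaleR_right)

lemma dual_space_scaleR: "dual_space (*\<^sub>R) = UNIV"
  by (simp add: dual_space_def blinfun.scaleR_right)

end

theory Submission
  imports Defs
begin

text \<open>The i-th coordinate projection maps the joint numerical range onto the numerical range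
  of \<open>T $ i\<close>, because both sets are indexed by the same state pairs. A linear image of
  a convex set is convex. Working with a general scalar multiplication \<open>s\<close> settles the
  real and the complex case at once.\<close>

lemma numerical_range_eq_image_joint_numerical_range:
  fixes s :: "'f::real_normed_field \<Rightarrow> 'x::real_normed_vector \<Rightarrow> 'x"
    and T :: "('x \<Rightarrow>\<^sub>L 'x) ^ 'k"
  shows "numerical_range s (T $ i) = (\<lambda>v. v $ i) ` joint_numerical_range s T"
proof -
  \<comment> \<open>Writing both ranges as images of \<open>state_pairs s\<close> reduces the claim
    to composing \<open>g\<close> with the projection.\<close>
  define g where "g = (\<lambda>(x, f :: 'x \<Rightarrow>\<^sub>L 'f). \<chi> j. blinfun_apply f (blinfun_apply (T $ j) x))"
  have "joint_numerical_range s T = g ` state_pairs s"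
    unfolding joint_numerical_range_def g_def by force
  moreover have "numerical_range s (T $ i) = (\<lambda>p. g p $ i) ` state_pairs s"
    unfolding numerical_range_def g_def by force
  ultimately show ?thesis
    by (simp add: image_image)
qed

text \<open>Convex combinations have real coefficients even over the complex field, so real
  linearity of the projection suffices.\<close>

lemma convex_numerical_range_if_joint:
  assumes "convex (joint_numerical_range s T)"
  shows "convex (numerical_range s (T $ i))"
  unfolding numerical_range_eq_image_joint_numerical_range
  by (intro convex_linear_image assms bounded_linear.linear bounded_linear_vec_nth)

theorem proposition2p1:
  shows "(\<forall>T :: ('x::banach \<Rightarrow>\<^sub>L 'x) ^ 'k::finite.
           (\<forall>i. T $ i \<in> bounded_operators (*\<^sub>R)) \<longrightarrow>
           convex (joint_numerical_range (*\<^sub>R) T) \<longrightarrow>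
           (\<forall>i. convex (numerical_range (*\<^sub>R) (T $ i)))) \<and>
         (\<forall>T :: ('y::complex_banach \<Rightarrow>\<^sub>L 'y) ^ 'k.
           (\<forall>i. T $ i \<in> bounded_operators (*\<^sub>C)) \<longrightarrow>
           convex (joint_numerical_range (*\<^sub>C) T) \<longrightarrow>
           (\<forall>i. convex (numerical_range (*\<^sub>C) (T $ i))))"
  by (simp add: convex_numerical_range_if_joint)

end
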